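(* Let $n=2$. For every fixed $\alpha\in(0,1)$, the Gaussian curvature function $\theta\mapsto K_G(\theta,\alpha)$ of $(\Omega,g_\alpha)$ is non-constant on $\Omega$.
   Context: Here $u:=e^{\theta^1}$, $v:=e^{\theta^2}$, $\Omega:=\{\theta=(\theta^1,\theta^2)\in\mathbb R^2: u+v<1\}$, $\Psi_+(\theta):=\log(1+u+v)$, $\Psi_-(\theta):=-\log(1-u-v)$, $\Psi_\alpha:=\alpha\Psi_++(1-\alpha)\Psi_-$ for $\alpha\in[0,1]$, and $g_\alpha:=\operatorname{Hess}_\theta\Psi_\alpha$, a Riemannian metric on $\Omega$. $K_G(\theta,\alpha)$ is the Gaussian curvature of $g_\alpha$ at $\theta$. *)

theory Defs
  imports "HOL-Analysis.Analysis"
begin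

section \<open>Riemannian metrics in a global chart\<close>

text \<open>
  A metric on an open subset of \<open>\<real>\<^sup>n\<close> is given by its matrix of coefficients with respect to
  the coordinate frame. All notions below are local, so their values on an open set
  depend only on the metric on that set; they are meaningful where the metric is smooth and
  positive definite.
\<close>

definition partial_deriv :: "'n::finite \<Rightarrow> (real^'n \<Rightarrow> real) \<Rightarrow> real^'n \<Rightarrow> real" where
  "partial_deriv i f x = deriv (\<lambda>t. f (x + t *\<^sub>R axis i 1)) 0"

definition Hess :: "(real^'n \<Rightarrow> real) \<Rightarrow> real^'n \<Rightarrow> real^'n^'n" where
  "Hess f x = (\<chi> i j. partial_deriv i (partial_deriv j f) x)"

text \<open>\<open>christoffel g k i j\<close> is \<open>\<Gamma>\<^sup>k\<^sub>i\<^sub>j\<close>, for the Levi-Civita connection of \<open>g\<close>.\<close>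

definition christoffel ::
    "(real^'n \<Rightarrow> real^'n^'n) \<Rightarrow> 'n \<Rightarrow> 'n \<Rightarrow> 'n \<Rightarrow> real^'n \<Rightarrow> real" where
  "christoffel g k i j x = (1/2) * (\<Sum>l\<in>UNIV. matrix_inv (g x) $ k $ l *
     (partial_deriv i (\<lambda>y. g y $ j $ l) x + partial_deriv j (\<lambda>y. g y $ i $ l) x
      - partial_deriv l (\<lambda>y. g y $ i $ j) x))"

text \<open>
  \<open>riemann_curvature g l k i j\<close> is the \<open>l\<close>-th component of \<open>R(\<partial>\<^sub>i, \<partial>\<^sub>j) \<partial>\<^sub>k\<close>, where
  \<open>R(X, Y) Z = \<nabla>\<^sub>X \<nabla>\<^sub>Y Z - \<nabla>\<^sub>Y \<nabla>\<^sub>X Z - \<nabla>\<^sub>[\<^sub>X\<^sub>,\<^sub>Y\<^sub>] Z\<close>.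
\<close>

definition riemann_curvature ::
    "(real^'n \<Rightarrow> real^'n^'n) \<Rightarrow> 'n \<Rightarrow> 'n \<Rightarrow> 'n \<Rightarrow> 'n \<Rightarrow> real^'n \<Rightarrow> real" where
  "riemann_curvature g l k i j x =
     partial_deriv i (christoffel g l j k) x - partial_deriv j (christoffel g l i k) x
     + (\<Sum>m\<in>UNIV. christoffel g l i m x * christoffel g m j k x
                 - christoffel g l j m x * christoffel g m i k x)"

text \<open>
  \<open>K = \<langle>R(\<partial>\<^sub>1, \<partial>\<^sub>2) \<partial>\<^sub>2, \<partial>\<^sub>1\<rangle> / (g\<^sub>1\<^sub>1 g\<^sub>2\<^sub>2 - g\<^sub>1\<^sub>2\<^sup>2)\<close>; with these signs
  the round unit sphere has curvature \<open>+1\<close>.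
\<close>

definition gaussian_curvature :: "(real^2 \<Rightarrow> real^2^2) \<Rightarrow> real^2 \<Rightarrow> real" where
  "gaussian_curvature g x =
     (\<Sum>l\<in>UNIV. g x $ 1 $ l * riemann_curvature g l 2 1 2 x) / det (g x)"

section \<open>The interpolating family of Hessian metrics\<close>

definition \<Omega> :: "(real^2) set" where
  "\<Omega> = {\<theta>. exp (\<theta> $ 1) + exp (\<theta> $ 2) < 1}"

definition \<Psi>_plus :: "real^2 \<Rightarrow> real" where
  "\<Psi>_plus \<theta> = ln (1 + exp (\<theta> $ 1) + exp (\<theta> $ 2))"

definition \<Psi>_minus :: "real^2 \<Rightarrow> real" where
  "\<Psi>_minus \<theta> = - ln (1 - exp (\<theta> $ 1) - exp (\<theta> $ 2))"

definition \<Psi> :: "real \<Rightarrow> real^2 \<Rightarrow> real" where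
  "\<Psi> \<alpha> \<theta> = \<alpha> * \<Psi>_plus \<theta> + (1 - \<alpha>) * \<Psi>_minus \<theta>"

definition g_metric :: "real \<Rightarrow> real^2 \<Rightarrow> real^2^2" where
  "g_metric \<alpha> = Hess (\<Psi> \<alpha>)"

definition K_G :: "real^2 \<Rightarrow> real \<Rightarrow> real" where
  "K_G \<theta> \<alpha> = gaussian_curvature (g_metric \<alpha>) \<theta>"

end

(*
  With s = u + v, both potentials have the form F(s), and in the coordinates 2 sqrt u, 2 sqrt v
  the metric Hess F(u + v) is rotationally symmetric: it is (h'/s) ds^2 + 4 h dphi^2 with
  h = s F'(s). So its curvature depends on s only, namely K = - (s h'/h)' / (4 h').
  In the chart theta the same value comes from the curvature of a Hessian metric, in which the
  fourth derivatives of the potential cancel by symmetry.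
  For Psi_alpha and b = 1 - 2 alpha this is a rational function of s on (0, 1) which tends to
  - b / 4 as s -> 0 and to - 1 / (2 (1 + b)) as s -> 1. These limits agree only if
  (b - 1)(b + 2) = 0, which is impossible for |b| < 1.
*)
theory Submission
  imports Defs
begin

section \<open>Partial derivatives along coordinate lines\<close>

definition has_partial_deriv :: "'n::finite \<Rightarrow> (real^'n \<Rightarrow> real) \<Rightarrow> real \<Rightarrow> real^'n \<Rightarrow> bool" where
  "has_partial_deriv i f d x \<longleftrightarrow> ((\<lambda>t. f (x + t *\<^sub>R axis i 1)) has_real_derivative d) (at 0)"

text \<open>A derivative at a point depends only on values nearby, and the preimage of
  \<open>S\<close> under the coordinate line is an open neighbourhood of 0. So closed forms valid on
  \<open>S\<close> alone may be differentiated. The relation \<open>has_partial_deriv\<close>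
  records that the derivative exists, which a value of \<open>deriv\<close> does not.\<close>

lemma partial_deriv_eq:
  assumes "open S" "x \<in> S" "\<forall>y\<in>S. f y = h y" "has_partial_deriv i h d x"
  shows "partial_deriv i f x = d"
proof -
  let ?T = "(\<lambda>t. x + t *\<^sub>R axis i 1) -` S"
  have "open ?T"
    by (intro open_vimage[OF assms(1)] continuous_intros)
  then have "((\<lambda>t. f (x + t *\<^sub>R axis i 1)) has_real_derivative d) (at 0)"
    by (rule has_field_derivative_transform_within_open[OF assms(4)[unfolded has_partial_deriv_def]])
       (simp_all add: assms(2,3))
  then show ?thesis
    unfolding partial_deriv_def by (rule DERIV_imp_deriv)
qed

section \<open>Inverse and curvature of a Hessian metric in dimension two\<close>

lemma matrix_inv_eqI:
  assumes "A ** B = mat 1" "B ** A = mat 1"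
  shows "matrix_inv A = B"
proof -
  have *: "A ** matrix_inv A = mat 1 \<and> matrix_inv A ** A = mat 1"
    unfolding matrix_inv_def by (rule someI[of _ B]) (use assms in simp)
  have "matrix_inv A = (B ** A) ** matrix_inv A"
    using assms by simp
  also have "\<dots> = B ** (A ** matrix_inv A)"
    by (rule matrix_mul_assoc[symmetric])
  also have "\<dots> = B"
    using * by simp
  finally show ?thesis .
qed

lemma matrix_inv_2:
  fixes m :: "real^2^2"
  assumes "m $ 1 $ 2 = m $ 2 $ 1" "det m \<noteq> 0"
  shows "matrix_inv m $ 1 $ 1 = m $ 2 $ 2 / det m" "matrix_inv m $ 1 $ 2 = - m $ 1 $ 2 / det m"
    "matrix_inv m $ 2 $ 1 = - m $ 1 $ 2 / det m" "matrix_inv m $ 2 $ 2 = m $ 1 $ 1 / det m"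
proof -
  define w :: "real^2^2" where
    "w = vector [vector [m $ 2 $ 2 / det m, - m $ 1 $ 2 / det m],
                 vector [- m $ 1 $ 2 / det m, m $ 1 $ 1 / det m]]"
  have "m ** w = mat 1" "w ** m = mat 1"
    using assms
    by (auto simp: vec_eq_iff matrix_matrix_mult_def w_def sum_2 forall_2 mat_def det_2
        divide_simps)
  then have "matrix_inv m = w"
    by (rule matrix_inv_eqI)
  then show "matrix_inv m $ 1 $ 1 = m $ 2 $ 2 / det m" "matrix_inv m $ 1 $ 2 = - m $ 1 $ 2 / det m"
    "matrix_inv m $ 2 $ 1 = - m $ 1 $ 2 / det m" "matrix_inv m $ 2 $ 2 = m $ 1 $ 1 / det m"
    by (simp_all add: w_def)
qed

text \<open>Here \<open>A\<close>, \<open>B\<close>, \<open>C\<close>, \<open>D\<close> are the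
  third derivatives 111, 112, 122, 222 of a potential, and \<open>P\<close>, \<open>Q\<close> the
  fourth derivatives 1122 and 1222. That the potential exists is expressed by shared names:
  \<open>B\<close> is both the 2-derivative of \<open>a\<close> and the 1-derivative of
  \<open>b\<close>, and so on. \<open>P\<close> and \<open>Q\<close> enter both differentiated
  Christoffel terms equally and cancel, leaving an expression quadratic in the third
  derivatives.\<close>

lemma gaussian_curvature_Hessian_metric:
  fixes g :: "real^2 \<Rightarrow> real^2^2"
  assumes S: "open S" "x \<in> S"
    and g: "\<And>y. y \<in> S \<Longrightarrow> g y $ 1 $ 1 = a y" "\<And>y. y \<in> S \<Longrightarrow> g y $ 1 $ 2 = b y"
      "\<And>y. y \<in> S \<Longrightarrow> g y $ 2 $ 1 = b y" "\<And>y. y \<in> S \<Longrightarrow> g y $ 2 $ 2 = c y"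
    and nz: "\<And>y. y \<in> S \<Longrightarrow> a y * c y - (b y)\<^sup>2 \<noteq> 0"
    and D2: "\<And>y. y \<in> S \<Longrightarrow> has_partial_deriv 1 a (A y) y"
      "\<And>y. y \<in> S \<Longrightarrow> has_partial_deriv 2 a (B y) y"
      "\<And>y. y \<in> S \<Longrightarrow> has_partial_deriv 1 b (B y) y"
      "\<And>y. y \<in> S \<Longrightarrow> has_partial_deriv 2 b (C y) y"
      "\<And>y. y \<in> S \<Longrightarrow> has_partial_deriv 1 c (C y) y"
      "\<And>y. y \<in> S \<Longrightarrow> has_partial_deriv 2 c (D y) y"
    and D3: "has_partial_deriv 2 B P x" "has_partial_deriv 1 C P x"
      "has_partial_deriv 2 C Q x" "has_partial_deriv 1 D Q x"
  shows "gaussian_curvature g x =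
     - (a x * (B x * D x - (C x)\<^sup>2) - b x * (A x * D x - B x * C x) + c x * (A x * C x - (B x)\<^sup>2))
       / (4 * (a x * c x - (b x)\<^sup>2)\<^sup>2)"
proof -
  let ?d = "\<lambda>y. a y * c y - (b y)\<^sup>2"
  have det: "det (g y) = ?d y" if "y \<in> S" for y
    using g that by (simp add: det_2 power2_eq_square)
  have inv: "matrix_inv (g y) $ 1 $ 1 = c y / ?d y" "matrix_inv (g y) $ 1 $ 2 = - b y / ?d y"
      "matrix_inv (g y) $ 2 $ 1 = - b y / ?d y" "matrix_inv (g y) $ 2 $ 2 = a y / ?d y"
    if "y \<in> S" for y
    using matrix_inv_2[of "g y"] det[OF that] g[OF that] nz[OF that] by simp_all
  have pd: "partial_deriv 1 (\<lambda>y. g y $ 1 $ 1) y = A y" "partial_deriv 2 (\<lambda>y. g y $ 1 $ 1) y = B y"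
     "partial_deriv 1 (\<lambda>y. g y $ 1 $ 2) y = B y" "partial_deriv 2 (\<lambda>y. g y $ 1 $ 2) y = C y"
     "partial_deriv 1 (\<lambda>y. g y $ 2 $ 1) y = B y" "partial_deriv 2 (\<lambda>y. g y $ 2 $ 1) y = C y"
     "partial_deriv 1 (\<lambda>y. g y $ 2 $ 2) y = C y" "partial_deriv 2 (\<lambda>y. g y $ 2 $ 2) y = D y"
    if "y \<in> S" for y
    by ((rule D2[OF that, THEN partial_deriv_eq[OF S(1) that, rotated]], rule ballI, rule g, assumption)+)
  \<comment> \<open>For a Hessian metric the three derivatives in a Christoffel symbol are the same
    third derivative, up to sign, so their combination collapses to one term.\<close>
  have chr: "\<forall>y\<in>S. christoffel g 1 1 1 y = (c y * A y - b y * B y) / (2 * ?d y)"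
    "\<forall>y\<in>S. christoffel g 1 1 2 y = (c y * B y - b y * C y) / (2 * ?d y)"
    "\<forall>y\<in>S. christoffel g 1 2 1 y = (c y * B y - b y * C y) / (2 * ?d y)"
    "\<forall>y\<in>S. christoffel g 1 2 2 y = (c y * C y - b y * D y) / (2 * ?d y)"
    "\<forall>y\<in>S. christoffel g 2 1 1 y = (a y * B y - b y * A y) / (2 * ?d y)"
    "\<forall>y\<in>S. christoffel g 2 1 2 y = (a y * C y - b y * B y) / (2 * ?d y)"
    "\<forall>y\<in>S. christoffel g 2 2 1 y = (a y * C y - b y * B y) / (2 * ?d y)"
    "\<forall>y\<in>S. christoffel g 2 2 2 y = (a y * D y - b y * C y) / (2 * ?d y)"
    by (simp_all add: christoffel_def sum_2 pd inv diff_divide_distrib mult.commute)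
  have nzx: "?d x \<noteq> 0" using nz S by blast
  \<comment> \<open>All the symbols have the shape (pq - rs) / (2d), so one quotient rule serves for
    every derivative of them.\<close>
  have quot: "has_partial_deriv i (\<lambda>y. (p y * q y - r y * s y) / (2 * ?d y))
      ((p' * q x + p x * q' - r' * s x - r x * s') / (2 * ?d x)
       - (p x * q x - r x * s x) * (a' * c x + a x * c' - 2 * b x * b') / (2 * (?d x)\<^sup>2)) x"
    if "has_partial_deriv i a a' x" "has_partial_deriv i b b' x" "has_partial_deriv i c c' x"
      "has_partial_deriv i p p' x" "has_partial_deriv i q q' x"
      "has_partial_deriv i r r' x" "has_partial_deriv i s s' x"
    for i p q r s a' b' c' p' q' r' s'
    using that nzx unfolding has_partial_deriv_def
    by (auto intro!: derivative_eq_intros simp: divide_simps)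
       (auto simp: power2_eq_square algebra_simps)
  note D2x = D2[OF S(2)]
  note quot1 = quot[OF D2x(1,3,5)] and quot2 = quot[OF D2x(2,4,6)]
  \<comment> \<open>Only the 1-derivatives of the symbols with lower indices 22 and the
    2-derivatives of those with lower indices 12 occur in R(1,2)2.\<close>
  note pchr =
    partial_deriv_eq[OF S chr(4) quot1[OF D2x(5) D3(2) D2x(3) D3(4)]]
    partial_deriv_eq[OF S chr(8) quot1[OF D2x(1) D3(4) D2x(3) D3(2)]]
    partial_deriv_eq[OF S chr(2) quot2[OF D2x(6) D3(1) D2x(4) D3(3)]]
    partial_deriv_eq[OF S chr(6) quot2[OF D2x(2) D3(3) D2x(4) D3(1)]]
  have combine: "p / (2 * d) - q / (2 * d\<^sup>2) - (p' / (2 * d) - q' / (2 * d\<^sup>2))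
        + (n1 / (2 * d) * (n2 / (2 * d)) - n3 / (2 * d) * (n4 / (2 * d))
        + (n5 / (2 * d) * (n6 / (2 * d)) - n7 / (2 * d) * (n8 / (2 * d))))
      = (2 * d * (p - p') - 2 * (q - q') + n1 * n2 - n3 * n4 + n5 * n6 - n7 * n8) / (4 * d\<^sup>2)"
    if "d \<noteq> 0" for d p q p' q' n1 n2 n3 n4 n5 n6 n7 n8 :: real
    using that by (simp add: divide_simps) (simp add: power2_eq_square algebra_simps)
  \<comment> \<open>Lowering the index makes the numerator a multiple of the determinant
    \<open>d\<close>, which cancels the division by \<open>det\<close>. What remains is a polynomial
    identity.\<close>
  have final: "(a' * (m / (4 * d\<^sup>2)) + b' * (n / (4 * d\<^sup>2))) / d = - k / (4 * d\<^sup>2)"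
    if "d \<noteq> 0" "a' * m + b' * n = - (d * k)" for a' b' m n k d :: real
  proof -
    have "(a' * (m / (4 * d\<^sup>2)) + b' * (n / (4 * d\<^sup>2))) / d = (a' * m + b' * n) / (4 * d\<^sup>2 * d)"
      by (simp add: add_divide_distrib)
    then show ?thesis
      unfolding that(2) using that(1) by simp
  qed
  show ?thesis
    unfolding gaussian_curvature_def riemann_curvature_def sum_2 chr[rule_format, OF S(2)]
      det[OF S(2)] pchr g[OF S(2)] combine[OF nzx]
    by (rule final[OF nzx]) algebra
qed

section \<open>Potentials that depend on s = u + v only\<close>

lemma has_partial_deriv_exp_nth:
  "has_partial_deriv i (\<lambda>y. exp (y $ j)) (if i = j then exp (x $ j) else 0) x"
  unfolding has_partial_deriv_def
  by (auto simp: axis_def intro!: derivative_eq_intros)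

text \<open>Since u and v reproduce themselves under their own partial derivative and vanish under
  the other, every derivative of the potential is a polynomial in u, v and the \<open>F1 s\<close>,
  ..., \<open>F4 s\<close>. With h = s F1, h' = F1 + s F2 and h'' = 2 F2 + s F3, the right-hand side
  is - (s h'/h)' / (4 h').\<close>

lemma gaussian_curvature_Hess_sum_exp:
  fixes \<theta> :: "real^2"
  assumes T: "open T"
    and F: "\<And>s. s \<in> T \<Longrightarrow> (F0 has_real_derivative F1 s) (at s)"
      "\<And>s. s \<in> T \<Longrightarrow> (F1 has_real_derivative F2 s) (at s)"
      "\<And>s. s \<in> T \<Longrightarrow> (F2 has_real_derivative F3 s) (at s)"
      "\<And>s. s \<in> T \<Longrightarrow> (F3 has_real_derivative F4 s) (at s)"
    and nz: "\<And>s. s \<in> T \<Longrightarrow> F1 s \<noteq> 0" "\<And>s. s \<in> T \<Longrightarrow> F1 s + s * F2 s \<noteq> 0"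
    and \<Phi>: "\<And>\<theta>. exp (\<theta> $ 1) + exp (\<theta> $ 2) \<in> T \<Longrightarrow> \<Phi> \<theta> = F0 (exp (\<theta> $ 1) + exp (\<theta> $ 2))"
    and s: "s = exp (\<theta> $ 1) + exp (\<theta> $ 2)" "s \<in> T"
  shows "gaussian_curvature (Hess \<Phi>) \<theta> =
    (s * (F1 s + s * F2 s)\<^sup>2 - (F1 s + s * F2 s + s * (2 * F2 s + s * F3 s)) * (s * F1 s))
      / (4 * (F1 s + s * F2 s) * (s * F1 s)\<^sup>2)"
proof -
  define u where "u = (\<lambda>y :: real^2. exp (y $ 1))"
  define v where "v = (\<lambda>y :: real^2. exp (y $ 2))"
  let ?s = "\<lambda>y. u y + v y"
  define S where "S = {y. ?s y \<in> T}"
  have "S = ?s -` T"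
    by (auto simp: S_def)
  then have S: "open S"
    unfolding u_def v_def by (auto intro!: open_vimage T continuous_intros)
  have \<theta>: "\<theta> \<in> S"
    using s by (simp add: S_def u_def v_def)
  have du: "((\<lambda>t. u (y + t *\<^sub>R axis 1 1)) has_real_derivative u y) (at 0)"
    "((\<lambda>t. u (y + t *\<^sub>R axis 2 1)) has_real_derivative 0) (at 0)"
    "((\<lambda>t. v (y + t *\<^sub>R axis 1 1)) has_real_derivative 0) (at 0)"
    "((\<lambda>t. v (y + t *\<^sub>R axis 2 1)) has_real_derivative v y) (at 0)" for y
    using has_partial_deriv_exp_nth[of 1 1 y] has_partial_deriv_exp_nth[of 2 1 y]
      has_partial_deriv_exp_nth[of 1 2 y] has_partial_deriv_exp_nth[of 2 2 y]
    by (simp_all add: u_def v_def has_partial_deriv_def)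
  have chain: "((\<lambda>t. G (?s (y + t *\<^sub>R axis 1 1))) has_real_derivative G' * u y) (at 0)"
      "((\<lambda>t. G (?s (y + t *\<^sub>R axis 2 1))) has_real_derivative G' * v y) (at 0)"
    if "(G has_real_derivative G') (at (?s y))" for G G' y
    using that by (auto intro!: derivative_eq_intros du DERIV_chain2[where f = G])
  have dF: "((\<lambda>t. F0 (?s (y + t *\<^sub>R axis 1 1))) has_real_derivative F1 (?s y) * u y) (at 0)"
    "((\<lambda>t. F0 (?s (y + t *\<^sub>R axis 2 1))) has_real_derivative F1 (?s y) * v y) (at 0)"
    "((\<lambda>t. F1 (?s (y + t *\<^sub>R axis 1 1))) has_real_derivative F2 (?s y) * u y) (at 0)"
    "((\<lambda>t. F1 (?s (y + t *\<^sub>R axis 2 1))) has_real_derivative F2 (?s y) * v y) (at 0)"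
    "((\<lambda>t. F2 (?s (y + t *\<^sub>R axis 1 1))) has_real_derivative F3 (?s y) * u y) (at 0)"
    "((\<lambda>t. F2 (?s (y + t *\<^sub>R axis 2 1))) has_real_derivative F3 (?s y) * v y) (at 0)"
    "((\<lambda>t. F3 (?s (y + t *\<^sub>R axis 1 1))) has_real_derivative F4 (?s y) * u y) (at 0)"
    "((\<lambda>t. F3 (?s (y + t *\<^sub>R axis 2 1))) has_real_derivative F4 (?s y) * v y) (at 0)"
    if "y \<in> S" for y
    using that by (auto simp: S_def intro!: chain F)
  have p1: "partial_deriv 1 \<Phi> y = F1 (?s y) * u y" "partial_deriv 2 \<Phi> y = F1 (?s y) * v y"
    if "y \<in> S" for y
    by (rule partial_deriv_eq[OF S that, where h = "\<lambda>y. F0 (?s y)"],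
        use \<Phi> dF(1,2)[OF that] in \<open>simp_all add: S_def u_def v_def has_partial_deriv_def\<close>)+
  let ?A = "\<lambda>y. F3 (?s y) * u y ^ 3 + 3 * F2 (?s y) * (u y)\<^sup>2 + F1 (?s y) * u y"
  let ?B = "\<lambda>y. F3 (?s y) * (u y)\<^sup>2 * v y + F2 (?s y) * u y * v y"
  let ?C = "\<lambda>y. F3 (?s y) * u y * (v y)\<^sup>2 + F2 (?s y) * u y * v y"
  let ?D = "\<lambda>y. F3 (?s y) * v y ^ 3 + 3 * F2 (?s y) * (v y)\<^sup>2 + F1 (?s y) * v y"
  let ?a = "\<lambda>y. F2 (?s y) * (u y)\<^sup>2 + F1 (?s y) * u y"
  let ?b = "\<lambda>y. F2 (?s y) * u y * v y"
  let ?c = "\<lambda>y. F2 (?s y) * (v y)\<^sup>2 + F1 (?s y) * v y"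
  have d1: "has_partial_deriv 1 (\<lambda>y. F1 (?s y) * u y) (?a y) y"
    "has_partial_deriv 2 (\<lambda>y. F1 (?s y) * u y) (?b y) y"
    "has_partial_deriv 1 (\<lambda>y. F1 (?s y) * v y) (?b y) y"
    "has_partial_deriv 2 (\<lambda>y. F1 (?s y) * v y) (?c y) y" if "y \<in> S" for y
    unfolding has_partial_deriv_def
    by (auto intro!: derivative_eq_intros du dF[OF that] simp: power2_eq_square)
  have hess: "Hess \<Phi> y $ 1 $ 1 = ?a y" "Hess \<Phi> y $ 1 $ 2 = ?b y"
    "Hess \<Phi> y $ 2 $ 1 = ?b y" "Hess \<Phi> y $ 2 $ 2 = ?c y" if "y \<in> S" for y
    unfolding Hess_def using that
    by (simp_all add: partial_deriv_eq[OF S that _ d1(1)[OF that]] p1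
        partial_deriv_eq[OF S that _ d1(2)[OF that]] partial_deriv_eq[OF S that _ d1(3)[OF that]]
        partial_deriv_eq[OF S that _ d1(4)[OF that]])
  \<comment> \<open>This factorization turns the two conditions \<open>nz\<close> into nondegeneracy
    of the metric.\<close>
  have det: "?a y * ?c y - (?b y)\<^sup>2 = u y * v y * F1 (?s y) * (F1 (?s y) + ?s y * F2 (?s y))" for y
    by algebra
  have pos: "u y > 0" "v y > 0" for y
    by (simp_all add: u_def v_def)
  have detnz: "?a y * ?c y - (?b y)\<^sup>2 \<noteq> 0" if "y \<in> S" for y
    unfolding det using that nz pos[of y] by (simp add: S_def)
  have d2: "has_partial_deriv 1 ?a (?A y) y" "has_partial_deriv 2 ?a (?B y) y"
     "has_partial_deriv 1 ?b (?B y) y" "has_partial_deriv 2 ?b (?C y) y"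
     "has_partial_deriv 1 ?c (?C y) y" "has_partial_deriv 2 ?c (?D y) y" if "y \<in> S" for y
    unfolding has_partial_deriv_def
    by (auto intro!: derivative_eq_intros du dF[OF that]
        simp: power2_eq_square power3_eq_cube algebra_simps)
  let ?P = "F4 (?s \<theta>) * (u \<theta>)\<^sup>2 * (v \<theta>)\<^sup>2 + F3 (?s \<theta>) * u \<theta> * v \<theta> * ?s \<theta> + F2 (?s \<theta>) * u \<theta> * v \<theta>"
  let ?Q = "F4 (?s \<theta>) * u \<theta> * v \<theta> ^ 3 + 3 * F3 (?s \<theta>) * u \<theta> * (v \<theta>)\<^sup>2 + F2 (?s \<theta>) * u \<theta> * v \<theta>"
  have d3: "has_partial_deriv 2 ?B ?P \<theta>" "has_partial_deriv 1 ?C ?P \<theta>"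
      "has_partial_deriv 2 ?C ?Q \<theta>" "has_partial_deriv 1 ?D ?Q \<theta>"
    unfolding has_partial_deriv_def
    by (auto intro!: derivative_eq_intros du dF[OF \<theta>]
        simp: power2_eq_square power3_eq_cube algebra_simps)
  have s': "s = ?s \<theta>"
    using s by (simp add: u_def v_def)
  have K: "gaussian_curvature (Hess \<Phi>) \<theta> =
     - (?a \<theta> * (?B \<theta> * ?D \<theta> - (?C \<theta>)\<^sup>2) - ?b \<theta> * (?A \<theta> * ?D \<theta> - ?B \<theta> * ?C \<theta>)
         + ?c \<theta> * (?A \<theta> * ?C \<theta> - (?B \<theta>)\<^sup>2)) / (4 * (?a \<theta> * ?c \<theta> - (?b \<theta>)\<^sup>2)\<^sup>2)"
    by (rule gaussian_curvature_Hessian_metric[OF S \<theta> hess detnz d2 d3])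
  \<comment> \<open>Stated for free reals so that \<open>algebra\<close> meets only atoms. Both
    sides equal (h' f2 - h'' f1) / (4 h' f1^2), after cancelling u^2 v^2 h' on the left and s^2 on
    the right.\<close>
  have "- ((f2 * u\<^sup>2 + f1 * u) * ((f3 * u\<^sup>2 * v + f2 * u * v) * (f3 * v ^ 3 + 3 * f2 * v\<^sup>2 + f1 * v)
              - (f3 * u * v\<^sup>2 + f2 * u * v)\<^sup>2)
          - f2 * u * v * ((f3 * u ^ 3 + 3 * f2 * u\<^sup>2 + f1 * u) * (f3 * v ^ 3 + 3 * f2 * v\<^sup>2 + f1 * v)
              - (f3 * u\<^sup>2 * v + f2 * u * v) * (f3 * u * v\<^sup>2 + f2 * u * v))
          + (f2 * v\<^sup>2 + f1 * v) * ((f3 * u ^ 3 + 3 * f2 * u\<^sup>2 + f1 * u) * (f3 * u * v\<^sup>2 + f2 * u * v)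
              - (f3 * u\<^sup>2 * v + f2 * u * v)\<^sup>2))
        / (4 * (u * v * f1 * (f1 + (u + v) * f2))\<^sup>2)
      = ((u + v) * (f1 + (u + v) * f2)\<^sup>2
          - (f1 + (u + v) * f2 + (u + v) * (2 * f2 + (u + v) * f3)) * ((u + v) * f1))
        / (4 * (f1 + (u + v) * f2) * ((u + v) * f1)\<^sup>2)"
    if "u > 0" "v > 0" "f1 \<noteq> 0" "f1 + (u + v) * f2 \<noteq> 0" for u v f1 f2 f3 :: real
  proof (rule frac_eq_eq[THEN iffD2])
    show "4 * (u * v * f1 * (f1 + (u + v) * f2))\<^sup>2 \<noteq> 0"
      "4 * (f1 + (u + v) * f2) * ((u + v) * f1)\<^sup>2 \<noteq> 0"
      using that by auto
  qed algebra
  then show ?thesis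
    unfolding K det s' using nz[OF s(2)] pos[of \<theta>] unfolding s' by blast
qed

section \<open>The curvature of the interpolating metrics as a rational function of s\<close>

lemma DERIV_divide_power:
  fixes c :: real
  assumes "(g has_real_derivative g') (at x)" "g x \<noteq> 0"
  shows "((\<lambda>x. c / g x ^ k) has_real_derivative - (real k * g' * c) / g x ^ Suc k) (at x)"
proof (cases k)
  case (Suc j)
  have "((\<lambda>x. g x ^ k) has_real_derivative real k * (g' * g x ^ j)) (at x)"
    unfolding Suc using DERIV_power_Suc[OF assms(1), of j] by simp
  from DERIV_divide[OF DERIV_const[of c] this]
  have "((\<lambda>x. c / g x ^ k) has_real_derivative
      (0 * g x ^ k - c * (real k * (g' * g x ^ j))) / (g x ^ k * g x ^ k)) (at x)"
    using assms(2) by simp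
  then show ?thesis
    by (rule DERIV_cong) (use assms(2) in \<open>simp add: Suc divide_simps\<close>)
qed simp

text \<open>Putting F1 and h' over powers of 1 - s^2 gives the numerators 1 + \<beta> s and 1 + 2
  \<beta> s + s^2. They inherit positivity from the partial fractions, whose terms are positive for
  0 < \<alpha> < 1 and 0 < s < 1.\<close>

lemma gaussian_curvature_g_metric:
  assumes \<alpha>: "0 < \<alpha>" "\<alpha> < 1" and s: "s = exp (\<theta> $ 1) + exp (\<theta> $ 2)" "s < 1"
  defines "\<beta> \<equiv> 1 - 2 * \<alpha>"
  shows "0 < 1 + \<beta> * s" "0 < 1 + 2 * \<beta> * s + s\<^sup>2"
    "K_G \<theta> \<alpha> = - (\<beta> * (1 - s\<^sup>2)\<^sup>2 + 4 * s * (1 + \<beta> * s)\<^sup>2)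
      / (4 * (1 + \<beta> * s)\<^sup>2 * (1 + 2 * \<beta> * s + s\<^sup>2))"
proof -
  let ?T = "{0<..<1 :: real}"
  let ?F0 = "\<lambda>s. \<alpha> * ln (1 + s) - (1 - \<alpha>) * ln (1 - s)"
  let ?F1 = "\<lambda>s. \<alpha> / (1 + s) + (1 - \<alpha>) / (1 - s)"
  let ?F2 = "\<lambda>s. - \<alpha> / (1 + s)\<^sup>2 + (1 - \<alpha>) / (1 - s)\<^sup>2"
  let ?F3 = "\<lambda>s. 2 * \<alpha> / (1 + s) ^ 3 + 2 * (1 - \<alpha>) / (1 - s) ^ 3"
  let ?F4 = "\<lambda>s. - 6 * \<alpha> / (1 + s) ^ 4 + 6 * (1 - \<alpha>) / (1 - s) ^ 4"
  have sT: "s \<in> ?T"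
    using s by (simp add: add_pos_pos)
  have F: "(?F0 has_real_derivative ?F1 s) (at s)" "(?F1 has_real_derivative ?F2 s) (at s)"
    "(?F2 has_real_derivative ?F3 s) (at s)" "(?F3 has_real_derivative ?F4 s) (at s)"
    if "s \<in> ?T" for s
  proof -
    have inv: "((\<lambda>s. c / (1 + s) ^ k) has_real_derivative - (real k * c) / (1 + s) ^ Suc k) (at s)"
      "((\<lambda>s. c / (1 - s) ^ k) has_real_derivative (real k * c) / (1 - s) ^ Suc k) (at s)" for c k
      using that DERIV_divide_power[of "\<lambda>s. 1 + s" 1 s c k] DERIV_divide_power[of "\<lambda>s. 1 - s" "-1" s c k]
        DERIV_add[OF DERIV_const DERIV_ident, of "1 :: real" s]
        DERIV_diff[OF DERIV_const DERIV_ident, of "1 :: real" s]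
      by simp_all
    show "(?F0 has_real_derivative ?F1 s) (at s)"
      using that by (auto intro!: derivative_eq_intros simp: divide_simps) (simp add: algebra_simps)
    show "(?F1 has_real_derivative ?F2 s) (at s)"
      using DERIV_add[OF inv(1)[of \<alpha> 1] inv(2)[of "1 - \<alpha>" 1]] by (simp add: numeral_2_eq_2)
    show "(?F2 has_real_derivative ?F3 s) (at s)"
      using DERIV_add[OF inv(1)[of "- \<alpha>" 2] inv(2)[of "1 - \<alpha>" 2]] by simp
    show "(?F3 has_real_derivative ?F4 s) (at s)"
      using DERIV_add[OF inv(1)[of "2 * \<alpha>" 3] inv(2)[of "2 * (1 - \<alpha>)" 3]] by simp
  qed
  \<comment> \<open>The left side is (s F1)', and the derivatives of s / (1 + s) and s / (1 - s) are
    1 / (1 + s)^2 and 1 / (1 - s)^2.\<close>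
  have F12: "?F1 s + s * ?F2 s = \<alpha> / (1 + s)\<^sup>2 + (1 - \<alpha>) / (1 - s)\<^sup>2" if "s \<in> ?T" for s
  proof -
    have "\<alpha> / (1 + s) = \<alpha> * (1 + s) / (1 + s)\<^sup>2" "(1 - \<alpha>) / (1 - s) = (1 - \<alpha>) * (1 - s) / (1 - s)\<^sup>2"
      using that by (auto simp: power2_eq_square)
    then show ?thesis
      by (simp add: add_divide_distrib diff_divide_distrib algebra_simps)
  qed
  have F1_pos: "?F1 s > 0" and F12_pos: "?F1 s + s * ?F2 s > 0" if "s \<in> ?T" for s
    unfolding F12[OF that] using that \<alpha> by (auto intro!: add_pos_pos)
  have "\<Psi> \<alpha> \<eta> = ?F0 (exp (\<eta> $ 1) + exp (\<eta> $ 2))" for \<eta>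
    by (simp add: \<Psi>_def \<Psi>_plus_def \<Psi>_minus_def add.assoc diff_diff_eq)
  then have K: "K_G \<theta> \<alpha> =
    (s * (?F1 s + s * ?F2 s)\<^sup>2 - (?F1 s + s * ?F2 s + s * (2 * ?F2 s + s * ?F3 s)) * (s * ?F1 s))
      / (4 * (?F1 s + s * ?F2 s) * (s * ?F1 s)\<^sup>2)"
    unfolding K_G_def g_metric_def
    using F1_pos F12_pos
    by (intro gaussian_curvature_Hess_sum_exp[OF _ F _ _ _ s(1) sT]) (auto simp: less_le)
  \<comment> \<open>With w = 1 - s^2, the functions F1, h' and h'' are p / w, m / w^2 and n / w^3.
    All powers of w cancel in the curvature.\<close>
  define p where "p = 1 + \<beta> * s"
  define m where "m = 1 + 2 * \<beta> * s + s\<^sup>2"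
  define n where "n = 2 * \<beta> * (1 + 3 * s\<^sup>2) + 2 * (3 * s + s ^ 3)"
  define w where "w = (1 + s) * (1 - s)"
  have w: "w > 0"
    using sT by (simp add: w_def)
  have F1: "?F1 s = p / w"
    using sT by (simp add: p_def w_def \<beta>_def divide_simps) algebra
  have F2: "?F1 s + s * ?F2 s = m / w\<^sup>2"
    unfolding F12[OF sT] using sT by (simp add: m_def w_def \<beta>_def divide_simps) algebra
  have F3: "2 * ?F2 s + s * ?F3 s = n / w ^ 3"
  proof -
    have F2': "?F2 s = - \<alpha> * (1 + s) / (1 + s) ^ 3 + (1 - \<alpha>) * (1 - s) / (1 - s) ^ 3"
      using sT by (simp add: power2_eq_square power3_eq_cube)
    have "2 * ?F2 s + s * ?F3 s = - 2 * \<alpha> / (1 + s) ^ 3 + 2 * (1 - \<alpha>) / (1 - s) ^ 3"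
      unfolding F2' by (simp add: add_divide_distrib diff_divide_distrib algebra_simps)
    also have "\<dots> = n / w ^ 3"
      using sT by (simp add: n_def w_def \<beta>_def divide_simps) algebra
    finally show ?thesis .
  qed
  show "0 < 1 + \<beta> * s" "0 < 1 + 2 * \<beta> * s + s\<^sup>2"
    using F1_pos[OF sT, unfolded F1] F12_pos[OF sT, unfolded F2] w
    by (simp_all add: zero_less_divide_iff p_def m_def)
  then have pm: "p > 0" "m > 0"
    by (simp_all add: p_def m_def)
  \<comment> \<open>The factor s found here, with the one already in the numerator, cancels the s^2
    of the denominator; the formula then makes sense at s = 0 too.\<close>
  have id: "m\<^sup>2 - (m * w + s * n) * p = - s * (\<beta> * (1 - s\<^sup>2)\<^sup>2 + 4 * s * p\<^sup>2)"
    unfolding m_def w_def n_def p_def by algebra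
  have "K_G \<theta> \<alpha> = s * (m\<^sup>2 - (m * w + s * n) * p) / (s * (s * (4 * p\<^sup>2 * m)))"
    unfolding K F2 F3 unfolding F1 using w pm sT
    by (simp add: divide_simps) algebra
  also have "\<dots> = - (\<beta> * (1 - s\<^sup>2)\<^sup>2 + 4 * s * p\<^sup>2) / (4 * p\<^sup>2 * m)"
    unfolding id using sT by (simp del: minus_add_distrib flip: minus_divide_left)
  finally show "K_G \<theta> \<alpha> = - (\<beta> * (1 - s\<^sup>2)\<^sup>2 + 4 * s * (1 + \<beta> * s)\<^sup>2)
      / (4 * (1 + \<beta> * s)\<^sup>2 * (1 + 2 * \<beta> * s + s\<^sup>2))"
    by (simp add: p_def m_def)
qed

section \<open>Comparison of the values at s = 0 and s = 1\<close>

theorem theorem3p5: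
  fixes \<alpha> :: real
  assumes "0 < \<alpha>" and "\<alpha> < 1"
  shows "\<not> (\<lambda>\<theta>. K_G \<theta> \<alpha>) constant_on \<Omega>"
proof
  assume "(\<lambda>\<theta>. K_G \<theta> \<alpha>) constant_on \<Omega>"
  then obtain c where c: "K_G \<theta> \<alpha> = c" if "\<theta> \<in> \<Omega>" for \<theta>
    unfolding constant_on_def by blast
  define \<beta> where "\<beta> = 1 - 2 * \<alpha>"
  \<comment> \<open>This is c - K times the denominator of K. Being a polynomial, it is continuous
    up to both endpoints, even though these correspond to no point of \<Omega>.\<close>
  define f where "f = (\<lambda>s. \<beta> * (1 - s\<^sup>2)\<^sup>2 + 4 * s * (1 + \<beta> * s)\<^sup>2
    + c * (4 * (1 + \<beta> * s)\<^sup>2 * (1 + 2 * \<beta> * s + s\<^sup>2)))"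
  have f0: "f s = 0" if s: "s \<in> {0<..<1}" for s
  proof -
    \<comment> \<open>The diagonal point u = v = s / 2 realizes any given s in (0, 1).\<close>
    define \<theta> :: "real^2" where "\<theta> = (\<chi> i. ln (s / 2))"
    have \<theta>: "s = exp (\<theta> $ 1) + exp (\<theta> $ 2)"
      using s by (simp add: \<theta>_def)
    then have "K_G \<theta> \<alpha> = c"
      using s by (intro c) (simp add: \<Omega>_def)
    then show "f s = 0"
      using gaussian_curvature_g_metric[OF assms \<theta>, folded \<beta>_def] s
      by (simp add: f_def divide_simps)
  qed
  have "continuous_on (closure {0<..<1}) f"
    unfolding f_def by (intro continuous_intros)
  note f_eq_0 = continuous_constant_on_closure[OF this f0]
  have "f 0 = 0" "f 1 = 0"
    by (auto intro!: f_eq_0)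
  then have c0: "\<beta> + 4 * c = 0" and c1: "(1 + \<beta>)\<^sup>2 * (4 + c * (4 * (2 + 2 * \<beta>))) = 0"
    by (auto simp: f_def algebra_simps)
  have \<beta>: "-1 < \<beta>" "\<beta> < 1"
    using assms by (auto simp: \<beta>_def)
  with c1 have "4 + c * (4 * (2 + 2 * \<beta>)) = 0"
    by simp
  \<comment> \<open>Substituting c = - \<beta> / 4 leaves \<beta>^2 + \<beta> - 2 = 0.\<close>
  with c0 have "(\<beta> - 1) * (\<beta> + 2) = 0"
    by algebra
  with \<beta> show False
    by simp
qed

end
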